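(* For any $\ell$-group $\mathbf{G}$, any sets $I,J$ with $|J|\le|I|$, and any injections $\lambda,\rho\colon J\to I$, the kite $K_{I,J}^{\lambda,\rho}(\mathbf{G})$ is a pseudo BL-algebra.
   Context: An FL-algebra is an algebra $\langle A;\wedge,\vee,\backslash,/,\cdot,0,1\rangle$ where $\langle A;\wedge,\vee\rangle$ is a lattice, $\langle A;\cdot,1\rangle$ a monoid, $xy\le z\iff y\le x\backslash z\iff x\le z/y$, and $0\in A$. A pseudo BL-algebra is an FL-algebra with $0\le x\le 1$, $x(x\backslash(x\wedge y))=x\wedge y=((x\wedge y)/x)x$, and $x\backslash y\vee y\backslash x=1=y/x\vee x/y$. Kites. Let $\mathbf{G}$ be an $\ell$-group (written multiplicatively, identity $e$), $G^+=\{g: g\ge e\}$, $G^-=\{g: g\le e\}$. Let $I,J$ be sets with $|J|\le|I|$ and $\lambda,\rho\colon J\to I$ injections. The kite $K_{I,J}^{\lambda,\rho}(\mathbf{G})$ is the algebra $\langle (G^+)^J\uplus(G^-)^I;\vee,\wedge,\cdot,\backslash,/,1,0\rangle$ (disjoint union) whose order is coordinatewise inside $(G^+)^J$ and inside $(G^-)^I$, with every element of $(G^+)^J$ below every element of $(G^-)^I$. Elements of $(G^-)^I$ are written $\langle a_i^{-1}\rangle_{i\in I}$ with $a_i\in G^+$, elements of $(G^+)^J$ as $\langle f_j\rangle_{j\in J}$; $e^{-1}$ denotes $e$ as an element of $G^-$. $1$ is the constant sequence $e^{-1}$ in $(G^-)^I$ and $0$ the constant sequence $e$ in $(G^+)^J$.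 Multiplication: $\langle a_i^{-1}\rangle\cdot\langle b_i^{-1}\rangle=\langle (b_ia_i)^{-1}\rangle$; $\langle a_i^{-1}\rangle\cdot\langle f_j\rangle=\langle a_{\lambda(j)}^{-1}f_j\vee e\rangle_{j\in J}$; $\langle f_j\rangle\cdot\langle a_i^{-1}\rangle=\langle f_ja_{\rho(j)}^{-1}\vee e\rangle_{j\in J}$; $\langle f_j\rangle\cdot\langle g_j\rangle=0$. Divisions: $\langle a_i^{-1}\rangle\backslash\langle b_i^{-1}\rangle=\langle a_ib_i^{-1}\wedge e^{-1}\rangle$; $\langle b_i^{-1}\rangle/\langle a_i^{-1}\rangle=\langle b_i^{-1}a_i\wedge e^{-1}\rangle$; $\langle a_i^{-1}\rangle\backslash\langle f_j\rangle=\langle a_{\lambda(j)}f_j\rangle_{j}$; $\langle f_j\rangle/\langle a_i^{-1}\rangle=\langle f_ja_{\rho(j)}\rangle_{j}$; $\langle f_j\rangle\backslash\langle g_j\rangle$ is the element of $(G^-)^I$ whose $i$-th coordinate is $f_{\rho^{-1}(i)}^{-1}g_{\rho^{-1}(i)}\wedge e^{-1}$ if $i\in\rho(J)$ and $e^{-1}$ otherwise; $\langle g_j\rangle/\langle f_j\rangle$ is the element of $(G^-)^I$ whose $i$-th coordinate is $g_{\lambda^{-1}(i)}f_{\lambda^{-1}(i)}^{-1}\wedge e^{-1}$ if $i\in\lambda(J)$ and $e^{-1}$ otherwise; $\langle a_i^{-1}\rangle/\langle f_j\rangle=1=\langle f_j\rangle\backslash\langle a_i^{-1}\rangle$. *)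

theory Defs
  imports "HOL-Algebra.Group" "HOL-Library.Equipollence"
begin

record 'a ordered_monoid = "'a monoid" +
  leq :: "'a \<Rightarrow> 'a \<Rightarrow> bool" (infix \<open>\<preceq>\<index>\<close> 50)

text \<open>The lattice structure is the order-theoretic one of HOL-Algebra: \<open>lattice (poset_of A)\<close>
  says that binary infima and suprema exist for \<open>leq A\<close>, and the lattice operations are
  \<open>meet\<close> and \<open>join\<close> of that poset.\<close>

definition poset_of :: "('a, 'b) ordered_monoid_scheme \<Rightarrow> 'a gorder" where
  "poset_of A = \<lparr>carrier = carrier A, eq = (=), le = leq A\<rparr>"

abbreviation poset_meet ::
  "('a, 'b) ordered_monoid_scheme \<Rightarrow> 'a \<Rightarrow> 'a \<Rightarrow> 'a" (infixl \<open>\<^bold>\<and>\<index>\<close> 65) where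
  "x \<^bold>\<and>\<^bsub>A\<^esub> y \<equiv> meet (poset_of A) x y"

abbreviation poset_join ::
  "('a, 'b) ordered_monoid_scheme \<Rightarrow> 'a \<Rightarrow> 'a \<Rightarrow> 'a" (infixl \<open>\<^bold>\<or>\<index>\<close> 65) where
  "x \<^bold>\<or>\<^bsub>A\<^esub> y \<equiv> join (poset_of A) x y"

locale l_group = group G + lattice "poset_of G"
  for G :: "('a, 'b) ordered_monoid_scheme" (structure) +
  assumes mult_mono:
    "\<lbrakk>a \<in> carrier G; b \<in> carrier G; c \<in> carrier G; d \<in> carrier G; a \<preceq> b\<rbrakk>
      \<Longrightarrow> c \<otimes> a \<otimes> d \<preceq> c \<otimes> b \<otimes> d"

record 'a fl_signature = "'a ordered_monoid" +
  ldiv :: "'a \<Rightarrow> 'a \<Rightarrow> 'a" (infix \<open>\<setminus>\<index>\<close> 66)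
  rdiv :: "'a \<Rightarrow> 'a \<Rightarrow> 'a" (infix \<open>\<^bold>'/\<index>\<close> 66)
  zero :: 'a (\<open>\<zero>\<index>\<close>)

locale fl_algebra = monoid A + lattice "poset_of A"
  for A :: "('a, 'b) fl_signature_scheme" (structure) +
  assumes ldiv_closed: "\<lbrakk>x \<in> carrier A; y \<in> carrier A\<rbrakk> \<Longrightarrow> x \<setminus> y \<in> carrier A"
    and rdiv_closed: "\<lbrakk>x \<in> carrier A; y \<in> carrier A\<rbrakk> \<Longrightarrow> x \<^bold>/ y \<in> carrier A"
    and zero_closed: "\<zero> \<in> carrier A"
    and ldiv_residual:
      "\<lbrakk>x \<in> carrier A; y \<in> carrier A; z \<in> carrier A\<rbrakk>
        \<Longrightarrow> x \<otimes> y \<preceq> z \<longleftrightarrow> y \<preceq> x \<setminus> z"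
    and rdiv_residual:
      "\<lbrakk>x \<in> carrier A; y \<in> carrier A; z \<in> carrier A\<rbrakk>
        \<Longrightarrow> x \<otimes> y \<preceq> z \<longleftrightarrow> x \<preceq> z \<^bold>/ y"

locale pseudo_bl_algebra = fl_algebra +
  assumes zero_least: "x \<in> carrier A \<Longrightarrow> \<zero> \<preceq> x"
    and one_greatest: "x \<in> carrier A \<Longrightarrow> x \<preceq> \<one>"
    and left_divisibility:
      "\<lbrakk>x \<in> carrier A; y \<in> carrier A\<rbrakk> \<Longrightarrow> x \<otimes> (x \<setminus> (x \<^bold>\<and> y)) = x \<^bold>\<and> y"
    and right_divisibility:
      "\<lbrakk>x \<in> carrier A; y \<in> carrier A\<rbrakk> \<Longrightarrow> ((x \<^bold>\<and> y) \<^bold>/ x) \<otimes> x = x \<^bold>\<and> y"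
    and left_prelinearity:
      "\<lbrakk>x \<in> carrier A; y \<in> carrier A\<rbrakk> \<Longrightarrow> (x \<setminus> y) \<^bold>\<or> (y \<setminus> x) = \<one>"
    and right_prelinearity:
      "\<lbrakk>x \<in> carrier A; y \<in> carrier A\<rbrakk> \<Longrightarrow> (y \<^bold>/ x) \<^bold>\<or> (x \<^bold>/ y) = \<one>"

definition pos_cone :: "('a, 'b) ordered_monoid_scheme \<Rightarrow> 'a set" where
  "pos_cone G = {g \<in> carrier G. \<one>\<^bsub>G\<^esub> \<preceq>\<^bsub>G\<^esub> g}"

definition neg_cone :: "('a, 'b) ordered_monoid_scheme \<Rightarrow> 'a set" where
  "neg_cone G = {g \<in> carrier G. g \<preceq>\<^bsub>G\<^esub> \<one>\<^bsub>G\<^esub>}"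

text \<open>Kite elements: \<open>Inl f\<close> is the sequence of positive elements \<open>f j\<close> over \<open>J\<close>, and \<open>Inr a\<close>
  is the sequence of negative elements \<open>a i\<close> over \<open>I\<close>.  Where the usual formulas write
  \<open>a\<^sub>i\<close> with \<open>a\<^sub>i\<close> positive for the sequence of inverses of the \<open>a\<^sub>i\<close>, here \<open>a i\<close> is the inverse of
  \<open>a\<^sub>i\<close>, so that \<open>a\<^sub>i\<close> becomes \<open>inv (a i)\<close>.  The binary sum type gives the disjoint union.\<close>

context
  fixes G :: "('g, 'm) ordered_monoid_scheme" (structure)
    and I :: "'i set" and J :: "'j set" and lam :: "'j \<Rightarrow> 'i" and rho :: "'j \<Rightarrow> 'i"
begin

definition kite_carrier :: "(('j \<Rightarrow> 'g) + ('i \<Rightarrow> 'g)) set" where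
  "kite_carrier = (J \<rightarrow>\<^sub>E pos_cone G) <+> (I \<rightarrow>\<^sub>E neg_cone G)"

fun kite_leq :: "('j \<Rightarrow> 'g) + ('i \<Rightarrow> 'g) \<Rightarrow> ('j \<Rightarrow> 'g) + ('i \<Rightarrow> 'g) \<Rightarrow> bool" where
  "kite_leq (Inl f) (Inl g) \<longleftrightarrow> (\<forall>j\<in>J. f j \<preceq> g j)"
| "kite_leq (Inr a) (Inr b) \<longleftrightarrow> (\<forall>i\<in>I. a i \<preceq> b i)"
| "kite_leq (Inl f) (Inr b) \<longleftrightarrow> True"
| "kite_leq (Inr a) (Inl g) \<longleftrightarrow> False"

definition kite_one :: "('j \<Rightarrow> 'g) + ('i \<Rightarrow> 'g)" where
  "kite_one = Inr (\<lambda>i\<in>I. \<one>)"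

definition kite_zero :: "('j \<Rightarrow> 'g) + ('i \<Rightarrow> 'g)" where
  "kite_zero = Inl (\<lambda>j\<in>J. \<one>)"

fun kite_mult ::
  "('j \<Rightarrow> 'g) + ('i \<Rightarrow> 'g) \<Rightarrow> ('j \<Rightarrow> 'g) + ('i \<Rightarrow> 'g) \<Rightarrow> ('j \<Rightarrow> 'g) + ('i \<Rightarrow> 'g)" where
  "kite_mult (Inr a) (Inr b) = Inr (\<lambda>i\<in>I. inv (inv (b i) \<otimes> inv (a i)))"
| "kite_mult (Inr a) (Inl f) = Inl (\<lambda>j\<in>J. (a (lam j) \<otimes> f j) \<^bold>\<or> \<one>)"
| "kite_mult (Inl f) (Inr a) = Inl (\<lambda>j\<in>J. (f j \<otimes> a (rho j)) \<^bold>\<or> \<one>)"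
| "kite_mult (Inl f) (Inl g) = kite_zero"

text \<open>\<open>kite_ldiv x y\<close> is \<open>x\<close> under \<open>y\<close>, whereas \<open>kite_rdiv y x\<close> is \<open>y\<close> over \<open>x\<close>.\<close>

fun kite_ldiv ::
  "('j \<Rightarrow> 'g) + ('i \<Rightarrow> 'g) \<Rightarrow> ('j \<Rightarrow> 'g) + ('i \<Rightarrow> 'g) \<Rightarrow> ('j \<Rightarrow> 'g) + ('i \<Rightarrow> 'g)" where
  "kite_ldiv (Inr a) (Inr b) = Inr (\<lambda>i\<in>I. (inv (a i) \<otimes> b i) \<^bold>\<and> \<one>)"
| "kite_ldiv (Inr a) (Inl f) = Inl (\<lambda>j\<in>J. inv (a (lam j)) \<otimes> f j)"
| "kite_ldiv (Inl f) (Inl g) = Inr (\<lambda>i\<in>I. if i \<in> rho ` J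
     then (inv (f (inv_into J rho i)) \<otimes> g (inv_into J rho i)) \<^bold>\<and> \<one> else \<one>)"
| "kite_ldiv (Inl f) (Inr a) = kite_one"

fun kite_rdiv ::
  "('j \<Rightarrow> 'g) + ('i \<Rightarrow> 'g) \<Rightarrow> ('j \<Rightarrow> 'g) + ('i \<Rightarrow> 'g) \<Rightarrow> ('j \<Rightarrow> 'g) + ('i \<Rightarrow> 'g)" where
  "kite_rdiv (Inr b) (Inr a) = Inr (\<lambda>i\<in>I. (b i \<otimes> inv (a i)) \<^bold>\<and> \<one>)"
| "kite_rdiv (Inl f) (Inr a) = Inl (\<lambda>j\<in>J. f j \<otimes> inv (a (rho j)))"
| "kite_rdiv (Inl g) (Inl f) = Inr (\<lambda>i\<in>I. if i \<in> lam ` J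
     then (g (inv_into J lam i) \<otimes> inv (f (inv_into J lam i))) \<^bold>\<and> \<one> else \<one>)"
| "kite_rdiv (Inr a) (Inl f) = kite_one"

definition kite :: "(('j \<Rightarrow> 'g) + ('i \<Rightarrow> 'g)) fl_signature" where
  "kite = \<lparr>carrier = kite_carrier, mult = kite_mult, one = kite_one, leq = kite_leq,
     ldiv = kite_ldiv, rdiv = kite_rdiv, zero = kite_zero\<rparr>"

end

end

theory Submission
  imports Defs
begin

text \<open>In an l-group, translations are order automorphisms, so \<open>a b <= c\<close> can be
  solved for either factor: \<open>b <= inv a c\<close> and \<open>a <= c inv b\<close>. The kite
  uses these group operations coordinatewise, truncated to the cone where the result must live:
  mixed products are joined with the identity e, and quotients of two sequences of the same kind are
  met with e. It remains to see, by cases on the summands, that truncation and re-indexing along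
  \<open>lam\<close> and \<open>rho\<close> do no harm.

  Associativity survives since \<open>b (x \<or> e) \<or> e = b x \<or> e\<close> for
  \<open>b <= e\<close> (\<open>mult_join_one\<close>, \<open>join_one_mult\<close>), and since
  \<open>lam\<close> serves only factors on the left and \<open>rho\<close> only factors on the
  right, so the two never compete. Residuation survives since the bound imposed by each truncation
  already holds of the element on the other side of the inequality. In divisibility the quotient of
  \<open>x \<and> y\<close> by x is already below e, so x cancels
  (\<open>mult_division_meet\<close>). Prelinearity is the identity
  \<open>(t \<and> e) \<or> (inv t \<and> e) = e\<close> (\<open>join_meet_inv\<close>) with t a
  quotient of x and y. Injectivity makes a quotient of positive sequences well defined on the image
  of the index map; elsewhere it is e and constrains nothing.\<close>

lemma carrier_poset_of [simp]: "carrier (poset_of A) = carrier A"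
  and le_poset_of [simp]: "le (poset_of A) = leq A"
  and eq_poset_of [simp]: "eq (poset_of A) = (=)"
  by (simp_all add: poset_of_def)

section \<open>Universal properties of joins and meets\<close>

context lattice
begin

lemma join_le_iff:
  "\<lbrakk>x \<in> carrier L; y \<in> carrier L; z \<in> carrier L\<rbrakk> \<Longrightarrow> x \<squnion> y \<sqsubseteq> z \<longleftrightarrow> x \<sqsubseteq> z \<and> y \<sqsubseteq> z"
  by (meson join_closed join_le join_left join_right le_trans)

lemma le_meet_iff:
  "\<lbrakk>x \<in> carrier L; y \<in> carrier L; z \<in> carrier L\<rbrakk> \<Longrightarrow> z \<sqsubseteq> x \<sqinter> y \<longleftrightarrow> z \<sqsubseteq> x \<and> z \<sqsubseteq> y"
  by (meson meet_closed meet_le meet_left meet_right le_trans)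

text \<open>Antisymmetry in Yoneda form: a lattice identity becomes an equivalence of inequalities,
  which residuation can then rewrite.\<close>

lemma eq_by_upper_bounds:
  "\<lbrakk>x \<in> carrier L; y \<in> carrier L; \<And>z. z \<in> carrier L \<Longrightarrow> x \<sqsubseteq> z \<longleftrightarrow> y \<sqsubseteq> z\<rbrakk> \<Longrightarrow> x = y"
  using le_antisym le_refl by blast

lemma eq_by_lower_bounds:
  "\<lbrakk>x \<in> carrier L; y \<in> carrier L; \<And>z. z \<in> carrier L \<Longrightarrow> z \<sqsubseteq> x \<longleftrightarrow> z \<sqsubseteq> y\<rbrakk> \<Longrightarrow> x = y"
  using le_antisym le_refl by blast

lemma join_eqI:
  "\<lbrakk>x \<in> carrier L; y \<in> carrier L; s \<in> carrier L;
    \<And>z. z \<in> carrier L \<Longrightarrow> s \<sqsubseteq> z \<longleftrightarrow> x \<sqsubseteq> z \<and> y \<sqsubseteq> z\<rbrakk> \<Longrightarrow> x \<squnion> y = s"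
  by (rule eq_by_upper_bounds) (simp_all add: join_le_iff)

lemma meet_eqI:
  "\<lbrakk>x \<in> carrier L; y \<in> carrier L; s \<in> carrier L;
    \<And>z. z \<in> carrier L \<Longrightarrow> z \<sqsubseteq> s \<longleftrightarrow> z \<sqsubseteq> x \<and> z \<sqsubseteq> y\<rbrakk> \<Longrightarrow> x \<sqinter> y = s"
  by (rule eq_by_lower_bounds) (simp_all add: le_meet_iff)

end

text \<open>Reduces the existence of suprema and infima to explicit operations \<open>s\<close> and
  \<open>m\<close> with the universal property, the form in which the kite order is handled.\<close>

lemma lattice_poset_ofI:
  assumes refl: "\<And>x. x \<in> carrier A \<Longrightarrow> leq A x x"
    and antisym: "\<And>x y. \<lbrakk>x \<in> carrier A; y \<in> carrier A; leq A x y; leq A y x\<rbrakk> \<Longrightarrow> x = y"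
    and trans: "\<And>x y z. \<lbrakk>x \<in> carrier A; y \<in> carrier A; z \<in> carrier A; leq A x y; leq A y z\<rbrakk>
      \<Longrightarrow> leq A x z"
    and s_closed: "\<And>x y. \<lbrakk>x \<in> carrier A; y \<in> carrier A\<rbrakk> \<Longrightarrow> s x y \<in> carrier A"
    and s_leq_iff: "\<And>x y z. \<lbrakk>x \<in> carrier A; y \<in> carrier A; z \<in> carrier A\<rbrakk>
      \<Longrightarrow> leq A (s x y) z \<longleftrightarrow> leq A x z \<and> leq A y z"
    and m_closed: "\<And>x y. \<lbrakk>x \<in> carrier A; y \<in> carrier A\<rbrakk> \<Longrightarrow> m x y \<in> carrier A"
    and leq_m_iff: "\<And>x y z. \<lbrakk>x \<in> carrier A; y \<in> carrier A; z \<in> carrier A\<rbrakk>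
      \<Longrightarrow> leq A z (m x y) \<longleftrightarrow> leq A z x \<and> leq A z y"
  shows "lattice (poset_of A)"
proof
  fix x y assume xy: "x \<in> carrier (poset_of A)" "y \<in> carrier (poset_of A)"
  have "least (poset_of A) (s x y) (Upper (poset_of A) {x, y})"
    using xy s_closed s_leq_iff[of x y] refl[of "s x y"]
    by (intro least_UpperI) (auto simp: Upper_def)
  then show "\<exists>l. least (poset_of A) l (Upper (poset_of A) {x, y})" ..
  have "greatest (poset_of A) (m x y) (Lower (poset_of A) {x, y})"
    using xy m_closed leq_m_iff[of x y] refl[of "m x y"]
    by (intro greatest_LowerI) (auto simp: Lower_def)
  then show "\<exists>l. greatest (poset_of A) l (Lower (poset_of A) {x, y})" ..
qed (auto intro: refl antisym trans)

section \<open>Arithmetic of l-groups\<close>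

context l_group
begin

lemma leq_refl [simp]: "x \<in> carrier G \<Longrightarrow> x \<preceq> x"
  using le_refl by simp

lemma leq_antisym: "\<lbrakk>x \<preceq> y; y \<preceq> x; x \<in> carrier G; y \<in> carrier G\<rbrakk> \<Longrightarrow> x = y"
  using le_antisym by simp

lemma leq_trans:
  "\<lbrakk>x \<preceq> y; y \<preceq> z; x \<in> carrier G; y \<in> carrier G; z \<in> carrier G\<rbrakk> \<Longrightarrow> x \<preceq> z"
  using le_trans[of x y z] by simp

lemma poset_join_closed [simp]: "\<lbrakk>x \<in> carrier G; y \<in> carrier G\<rbrakk> \<Longrightarrow> x \<^bold>\<or> y \<in> carrier G"
  using join_closed by simp

lemma poset_meet_closed [simp]: "\<lbrakk>x \<in> carrier G; y \<in> carrier G\<rbrakk> \<Longrightarrow> x \<^bold>\<and> y \<in> carrier G"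
  using meet_closed by simp

lemma poset_join_leq_iff [simp]:
  "\<lbrakk>x \<in> carrier G; y \<in> carrier G; z \<in> carrier G\<rbrakk> \<Longrightarrow> x \<^bold>\<or> y \<preceq> z \<longleftrightarrow> x \<preceq> z \<and> y \<preceq> z"
  using join_le_iff by simp

lemma leq_poset_meet_iff [simp]:
  "\<lbrakk>x \<in> carrier G; y \<in> carrier G; z \<in> carrier G\<rbrakk> \<Longrightarrow> z \<preceq> x \<^bold>\<and> y \<longleftrightarrow> z \<preceq> x \<and> z \<preceq> y"
  using le_meet_iff by simp

lemma leq_poset_join [simp]:
  "\<lbrakk>x \<in> carrier G; y \<in> carrier G\<rbrakk> \<Longrightarrow> x \<preceq> x \<^bold>\<or> y"
  "\<lbrakk>x \<in> carrier G; y \<in> carrier G\<rbrakk> \<Longrightarrow> y \<preceq> x \<^bold>\<or> y"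
  using join_left join_right by simp_all

lemma poset_meet_leq [simp]:
  "\<lbrakk>x \<in> carrier G; y \<in> carrier G\<rbrakk> \<Longrightarrow> x \<^bold>\<and> y \<preceq> x"
  "\<lbrakk>x \<in> carrier G; y \<in> carrier G\<rbrakk> \<Longrightarrow> x \<^bold>\<and> y \<preceq> y"
  using meet_left meet_right by simp_all

lemmas eq_by_leq = eq_by_upper_bounds[simplified]
lemmas eq_by_geq = eq_by_lower_bounds[simplified]

lemma poset_join_absorb:
  "\<lbrakk>y \<preceq> x; x \<in> carrier G; y \<in> carrier G\<rbrakk> \<Longrightarrow> x \<^bold>\<or> y = x"
  by (rule leq_antisym) auto

lemma poset_meet_absorb:
  "\<lbrakk>x \<preceq> y; x \<in> carrier G; y \<in> carrier G\<rbrakk> \<Longrightarrow> x \<^bold>\<and> y = x"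
  by (rule leq_antisym) auto

lemma mult_leq_mono_left:
  "\<lbrakk>a \<preceq> b; a \<in> carrier G; b \<in> carrier G; c \<in> carrier G\<rbrakk> \<Longrightarrow> c \<otimes> a \<preceq> c \<otimes> b"
  using mult_mono[of a b c \<one>] by simp

lemma mult_leq_mono_right:
  "\<lbrakk>a \<preceq> b; a \<in> carrier G; b \<in> carrier G; c \<in> carrier G\<rbrakk> \<Longrightarrow> a \<otimes> c \<preceq> b \<otimes> c"
  using mult_mono[of a b \<one> c] by simp

text \<open>Multiplying by an element and multiplying by its inverse are mutually inverse monotone
  maps. This is residuation in G, from which that of the kite is derived.\<close>

lemma mult_leq_iff_left:
  assumes "a \<in> carrier G" "b \<in> carrier G" "c \<in> carrier G"
  shows "a \<otimes> b \<preceq> c \<longleftrightarrow> b \<preceq> inv a \<otimes> c"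
  using mult_leq_mono_left[of "a \<otimes> b" c "inv a"] mult_leq_mono_left[of b "inv a \<otimes> c" a] assms
  by (auto simp: m_assoc[symmetric])

lemma mult_leq_iff_right:
  assumes "a \<in> carrier G" "b \<in> carrier G" "c \<in> carrier G"
  shows "a \<otimes> b \<preceq> c \<longleftrightarrow> a \<preceq> c \<otimes> inv b"
  using mult_leq_mono_right[of "a \<otimes> b" c "inv b"] mult_leq_mono_right[of a "c \<otimes> inv b" b] assms
  by (auto simp: m_assoc)

lemma mult_inv_cancel:
  assumes "x \<in> carrier G" "y \<in> carrier G"
  shows "x \<otimes> (inv x \<otimes> y) = y" "y \<otimes> inv x \<otimes> x = y"
  using assms by (simp_all add: m_assoc[of y] m_assoc[of x "inv x" y, symmetric])

text \<open>Translation has an adjoint by \<open>mult_leq_iff_left\<close>, so it preserves joins: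
  both sides have the same upper bounds.\<close>

lemma mult_poset_join:
  assumes "a \<in> carrier G" "b \<in> carrier G" "c \<in> carrier G"
  shows "c \<otimes> (a \<^bold>\<or> b) = (c \<otimes> a) \<^bold>\<or> (c \<otimes> b)"
  using assms by (intro eq_by_leq) (simp_all add: mult_leq_iff_left)

lemma poset_join_mult:
  assumes "a \<in> carrier G" "b \<in> carrier G" "c \<in> carrier G"
  shows "(a \<^bold>\<or> b) \<otimes> c = (a \<otimes> c) \<^bold>\<or> (b \<otimes> c)"
  using assms by (intro eq_by_leq) (simp_all add: mult_leq_iff_right)

lemma inv_leq_iff:
  assumes "a \<in> carrier G" "b \<in> carrier G"
  shows "inv a \<preceq> b \<longleftrightarrow> inv b \<preceq> a"
  using mult_leq_iff_left[of a "inv b" \<one>] mult_leq_iff_right[of a "inv b" \<one>]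
    mult_leq_iff_right[of "inv a" "inv b" \<one>] mult_leq_iff_left[of "inv a" "inv b" \<one>] assms
  by simp

text \<open>The two meets are \<open>t \<otimes> v\<close> and \<open>v\<close> where \<open>v = inv t \<^bold>\<and> \<one>\<close>, so
  their join is \<open>(t \<^bold>\<or> \<one>) \<otimes> v\<close>, and \<open>t \<^bold>\<or> \<one>\<close> is the inverse of \<open>v\<close>.\<close>

lemma join_meet_inv:
  assumes t: "t \<in> carrier G"
  shows "(t \<^bold>\<and> \<one>) \<^bold>\<or> (inv t \<^bold>\<and> \<one>) = \<one>"
proof -
  define v where "v = inv t \<^bold>\<and> \<one>"
  have v: "v \<in> carrier G" using t by (simp add: v_def)
  have "t \<^bold>\<and> \<one> = t \<otimes> v"
  proof (rule eq_by_geq)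
    fix z assume z: "z \<in> carrier G"
    show "z \<preceq> t \<^bold>\<and> \<one> \<longleftrightarrow> z \<preceq> t \<otimes> v"
      using t z v mult_leq_iff_left[of "inv t" z v] mult_leq_iff_left[of "inv t" z \<one>]
        mult_leq_iff_left[of "inv t" z "inv t"]
      by (auto simp: v_def)
  qed (use t v in simp_all)
  moreover have "t \<^bold>\<or> \<one> = inv v"
  proof (rule eq_by_leq)
    fix z assume z: "z \<in> carrier G"
    show "t \<^bold>\<or> \<one> \<preceq> z \<longleftrightarrow> inv v \<preceq> z"
      using t z v inv_leq_iff[of v z] inv_leq_iff[of "inv t" z] inv_leq_iff[of \<one> z]
      by (auto simp: v_def)
  qed (use t v in simp_all)
  ultimately show ?thesis
    using poset_join_mult[of t \<one> v] t v by (simp add: v_def)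
qed

lemma left_prelinear:
  assumes "x \<in> carrier G" "y \<in> carrier G"
  shows "(inv x \<otimes> y \<^bold>\<and> \<one>) \<^bold>\<or> (inv y \<otimes> x \<^bold>\<and> \<one>) = \<one>"
  using join_meet_inv[of "inv x \<otimes> y"] assms by (simp add: inv_mult_group)

lemma right_prelinear:
  assumes "x \<in> carrier G" "y \<in> carrier G"
  shows "(y \<otimes> inv x \<^bold>\<and> \<one>) \<^bold>\<or> (x \<otimes> inv y \<^bold>\<and> \<one>) = \<one>"
  using join_meet_inv[of "y \<otimes> inv x"] assms by (simp add: inv_mult_group)

lemma mult_neg:
  assumes "a \<in> carrier G" "b \<in> carrier G" "a \<preceq> \<one>" "b \<preceq> \<one>"
  shows "a \<otimes> b \<preceq> \<one>"
  using assms mult_leq_mono_left[of b \<one> a] leq_trans[of "a \<otimes> b" a \<one>] by simp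

lemma inv_neg_mult_pos:
  assumes "a \<in> carrier G" "f \<in> carrier G" "a \<preceq> \<one>" "\<one> \<preceq> f"
  shows "\<one> \<preceq> inv a \<otimes> f" "\<one> \<preceq> f \<otimes> inv a"
  using assms leq_trans[of a \<one> f] mult_leq_iff_left[of a \<one> f] mult_leq_iff_right[of \<one> a f]
  by simp_all

lemma join_one_mult:
  assumes "x \<in> carrier G" "b \<in> carrier G" "b \<preceq> \<one>"
  shows "((x \<^bold>\<or> \<one>) \<otimes> b) \<^bold>\<or> \<one> = (x \<otimes> b) \<^bold>\<or> \<one>"
  using assms by (intro eq_by_leq) (auto simp: poset_join_mult intro: leq_trans)

lemma mult_join_one:
  assumes "x \<in> carrier G" "b \<in> carrier G" "b \<preceq> \<one>"
  shows "(b \<otimes> (x \<^bold>\<or> \<one>)) \<^bold>\<or> \<one> = (b \<otimes> x) \<^bold>\<or> \<one>"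
  using assms by (intro eq_by_leq) (auto simp: mult_poset_join intro: leq_trans)

lemma join_one_neg: "b \<in> carrier G \<Longrightarrow> b \<preceq> \<one> \<Longrightarrow> b \<^bold>\<or> \<one> = \<one>"
  by (rule leq_antisym) auto

text \<open>Since the meet is below x, its quotient by x is already below the identity; the
  truncation does nothing and x cancels.\<close>

lemma mult_division_meet:
  assumes "x \<in> carrier G" "y \<in> carrier G"
  shows "x \<otimes> (inv x \<otimes> (x \<^bold>\<and> y) \<^bold>\<and> \<one>) = x \<^bold>\<and> y"
    and "((x \<^bold>\<and> y) \<otimes> inv x \<^bold>\<and> \<one>) \<otimes> x = x \<^bold>\<and> y"
proof -
  have "inv x \<otimes> (x \<^bold>\<and> y) \<preceq> \<one>" "(x \<^bold>\<and> y) \<otimes> inv x \<preceq> \<one>"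
    using assms mult_leq_iff_left[of "inv x" "x \<^bold>\<and> y" \<one>]
      mult_leq_iff_right[of "x \<^bold>\<and> y" "inv x" \<one>] by simp_all
  then show "x \<otimes> (inv x \<otimes> (x \<^bold>\<and> y) \<^bold>\<and> \<one>) = x \<^bold>\<and> y"
    and "((x \<^bold>\<and> y) \<otimes> inv x \<^bold>\<and> \<one>) \<otimes> x = x \<^bold>\<and> y"
    using assms by (simp_all add: poset_meet_absorb mult_inv_cancel)
qed

end

section \<open>Coordinates and elements of the kite\<close>

lemma restrict_eqI:
  "\<lbrakk>f \<in> Pi\<^sub>E A B; \<And>x. x \<in> A \<Longrightarrow> g x = f x\<rbrakk> \<Longrightarrow> restrict g A = f"
  by (metis PiE_restrict restrict_ext)

text \<open>Re-indexes a condition on the image of an injection by its domain. It turns the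
  coordinates of a quotient of positive sequences, indexed by I, into conditions over J.\<close>

lemma ball_inv_into_iff:
  assumes "r \<in> J \<rightarrow> I" "inj_on r J"
  shows "(\<forall>i\<in>I. i \<in> r ` J \<longrightarrow> P (inv_into J r i) i) \<longleftrightarrow> (\<forall>j\<in>J. P j (r j))"
  using assms by (auto simp: inv_into_f_f)

locale kite_index = l_group G
  for G :: "('g, 'm) ordered_monoid_scheme" (structure) +
  fixes I :: "'i set" and J :: "'j set" and lam rho :: "'j \<Rightarrow> 'i"
  assumes lam: "lam \<in> J \<rightarrow> I" "inj_on lam J"
    and rho: "rho \<in> J \<rightarrow> I" "inj_on rho J"
begin

abbreviation "K \<equiv> kite G I J lam rho"

lemma kite_simps [simp]:
  "carrier K = kite_carrier G I J"
  "mult K = kite_mult G I J lam rho"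
  "one K = kite_one G I"
  "leq K = kite_leq G I J"
  "ldiv K = kite_ldiv G I J lam rho"
  "rdiv K = kite_rdiv G I J lam rho"
  "zero K = kite_zero G J"
  by (simp_all add: kite_def)

lemma kite_carrier_cases [consumes 1, case_names pos neg]:
  assumes "x \<in> kite_carrier G I J"
  obtains f where "x = Inl f" "f \<in> J \<rightarrow>\<^sub>E pos_cone G"
  | a where "x = Inr a" "a \<in> I \<rightarrow>\<^sub>E neg_cone G"
  using assms by (auto simp: kite_carrier_def)

lemma Inl_mem_iff [simp]: "Inl f \<in> kite_carrier G I J \<longleftrightarrow> f \<in> J \<rightarrow>\<^sub>E pos_cone G"
  and Inr_mem_iff [simp]: "Inr a \<in> kite_carrier G I J \<longleftrightarrow> a \<in> I \<rightarrow>\<^sub>E neg_cone G"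
  by (auto simp: kite_carrier_def)

lemma pos_memD:
  assumes "f \<in> J \<rightarrow>\<^sub>E pos_cone G" "j \<in> J"
  shows "f j \<in> carrier G" "\<one> \<preceq> f j"
  using PiE_mem[OF assms] by (auto simp: pos_cone_def)

lemma neg_memD:
  assumes "a \<in> I \<rightarrow>\<^sub>E neg_cone G"
  shows "i \<in> I \<Longrightarrow> a i \<in> carrier G" "i \<in> I \<Longrightarrow> a i \<preceq> \<one>"
    "j \<in> J \<Longrightarrow> a (lam j) \<in> carrier G" "j \<in> J \<Longrightarrow> a (lam j) \<preceq> \<one>"
    "j \<in> J \<Longrightarrow> a (rho j) \<in> carrier G" "j \<in> J \<Longrightarrow> a (rho j) \<preceq> \<one>"
  using assms PiE_mem[OF assms] lam rho by (auto simp: neg_cone_def Pi_iff)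

lemmas memD = pos_memD neg_memD

lemma index_mem [simp]: "j \<in> J \<Longrightarrow> lam j \<in> I" "j \<in> J \<Longrightarrow> rho j \<in> I"
  using lam rho by auto

lemma pos_Pi_iff: "f \<in> J \<rightarrow> pos_cone G \<longleftrightarrow> (\<forall>j\<in>J. f j \<in> carrier G \<and> \<one> \<preceq> f j)"
  and neg_Pi_iff: "a \<in> I \<rightarrow> neg_cone G \<longleftrightarrow> (\<forall>i\<in>I. a i \<in> carrier G \<and> a i \<preceq> \<one>)"
  by (auto simp: pos_cone_def neg_cone_def)

lemma pos_eq_iff:
  "f \<in> J \<rightarrow>\<^sub>E pos_cone G \<Longrightarrow> g \<in> J \<rightarrow>\<^sub>E pos_cone G \<Longrightarrow> f = g \<longleftrightarrow> (\<forall>j\<in>J. f j = g j)"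
  by (metis PiE_ext)

lemma neg_eq_iff:
  "a \<in> I \<rightarrow>\<^sub>E neg_cone G \<Longrightarrow> b \<in> I \<rightarrow>\<^sub>E neg_cone G \<Longrightarrow> a = b \<longleftrightarrow> (\<forall>i\<in>I. a i = b i)"
  by (metis PiE_ext)

lemma inv_into_index_mem [simp]:
  "i \<in> lam ` J \<Longrightarrow> inv_into J lam i \<in> J" "i \<in> rho ` J \<Longrightarrow> inv_into J rho i \<in> J"
  by (simp_all add: inv_into_into)

lemma kite_one_closed: "kite_one G I \<in> kite_carrier G I J"
  by (simp add: kite_one_def neg_Pi_iff)

lemma kite_zero_closed: "kite_zero G J \<in> kite_carrier G I J"
  by (simp add: kite_zero_def pos_Pi_iff)

section \<open>Closure and the monoid structure\<close>

lemma kite_mult_closed: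
  assumes "x \<in> kite_carrier G I J" "y \<in> kite_carrier G I J"
  shows "kite_mult G I J lam rho x y \<in> kite_carrier G I J"
  using assms(1)
proof (cases rule: kite_carrier_cases)
  case x: pos
  from assms(2) show ?thesis
    by (cases rule: kite_carrier_cases)
      (use x kite_zero_closed in \<open>simp_all add: pos_Pi_iff memD\<close>)
next
  case x: neg
  from assms(2) show ?thesis
    by (cases rule: kite_carrier_cases)
      (use x in \<open>simp_all add: pos_Pi_iff neg_Pi_iff memD inv_mult_group mult_neg\<close>)
qed

lemma kite_ldiv_closed:
  assumes "x \<in> kite_carrier G I J" "y \<in> kite_carrier G I J"
  shows "kite_ldiv G I J lam rho x y \<in> kite_carrier G I J"
  using assms(1)
proof (cases rule: kite_carrier_cases)
  case x: pos
  from assms(2) show ?thesis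
    by (cases rule: kite_carrier_cases)
      (use x kite_one_closed in \<open>simp_all add: neg_Pi_iff memD\<close>)
next
  case x: neg
  from assms(2) show ?thesis
    by (cases rule: kite_carrier_cases)
      (use x in \<open>simp_all add: pos_Pi_iff neg_Pi_iff memD inv_neg_mult_pos\<close>)
qed

lemma kite_rdiv_closed:
  assumes "x \<in> kite_carrier G I J" "y \<in> kite_carrier G I J"
  shows "kite_rdiv G I J lam rho x y \<in> kite_carrier G I J"
  using assms(1)
proof (cases rule: kite_carrier_cases)
  case x: pos
  from assms(2) show ?thesis
    by (cases rule: kite_carrier_cases)
      (use x in \<open>simp_all add: pos_Pi_iff neg_Pi_iff memD inv_neg_mult_pos\<close>)
next
  case x: neg
  from assms(2) show ?thesis
    by (cases rule: kite_carrier_cases)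
      (use x kite_one_closed in \<open>simp_all add: neg_Pi_iff memD\<close>)
qed

text \<open>With two or more positive factors both sides are zero, because a negative factor keeps
  zero fixed (\<open>join_one_neg\<close>). With one positive factor the inner truncations drop out,
  leaving group associativity: left factors are read at \<open>lam j\<close>, right factors at
  \<open>rho j\<close>.\<close>

lemma kite_mult_assoc:
  assumes "x \<in> kite_carrier G I J" "y \<in> kite_carrier G I J" "z \<in> kite_carrier G I J"
  shows "kite_mult G I J lam rho (kite_mult G I J lam rho x y) z
    = kite_mult G I J lam rho x (kite_mult G I J lam rho y z)"
  using assms
  by (elim kite_carrier_cases)
    (auto simp: kite_zero_def memD inv_mult_group m_assoc join_one_mult mult_join_one join_one_neg
      intro!: restrict_ext)

lemma kite_mult_one:
  assumes "x \<in> kite_carrier G I J"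
  shows "kite_mult G I J lam rho x (kite_one G I) = x"
    and "kite_mult G I J lam rho (kite_one G I) x = x"
  using assms
  by (auto elim!: kite_carrier_cases simp: kite_one_def memD poset_join_absorb
      intro!: restrict_eqI)

section \<open>The lattice structure, with explicit joins and meets\<close>

fun kite_join :: "('j \<Rightarrow> 'g) + ('i \<Rightarrow> 'g) \<Rightarrow> ('j \<Rightarrow> 'g) + ('i \<Rightarrow> 'g) \<Rightarrow> ('j \<Rightarrow> 'g) + ('i \<Rightarrow> 'g)"
where
  "kite_join (Inl f) (Inl g) = Inl (\<lambda>j\<in>J. f j \<^bold>\<or> g j)"
| "kite_join (Inl f) (Inr b) = Inr b"
| "kite_join (Inr a) (Inl g) = Inr a"
| "kite_join (Inr a) (Inr b) = Inr (\<lambda>i\<in>I. a i \<^bold>\<or> b i)"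

fun kite_meet :: "('j \<Rightarrow> 'g) + ('i \<Rightarrow> 'g) \<Rightarrow> ('j \<Rightarrow> 'g) + ('i \<Rightarrow> 'g) \<Rightarrow> ('j \<Rightarrow> 'g) + ('i \<Rightarrow> 'g)"
where
  "kite_meet (Inl f) (Inl g) = Inl (\<lambda>j\<in>J. f j \<^bold>\<and> g j)"
| "kite_meet (Inl f) (Inr b) = Inl f"
| "kite_meet (Inr a) (Inl g) = Inl g"
| "kite_meet (Inr a) (Inr b) = Inr (\<lambda>i\<in>I. a i \<^bold>\<and> b i)"

lemma kite_join_closed:
  "\<lbrakk>x \<in> kite_carrier G I J; y \<in> kite_carrier G I J\<rbrakk> \<Longrightarrow> kite_join x y \<in> kite_carrier G I J"
  by (elim kite_carrier_cases)
    (auto simp: pos_cone_def neg_cone_def memD intro: leq_trans[OF _ leq_poset_join(1)])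

lemma kite_meet_closed:
  "\<lbrakk>x \<in> kite_carrier G I J; y \<in> kite_carrier G I J\<rbrakk> \<Longrightarrow> kite_meet x y \<in> kite_carrier G I J"
  by (elim kite_carrier_cases)
    (auto simp: pos_cone_def neg_cone_def memD intro: leq_trans[OF poset_meet_leq(1)])

lemma kite_join_leq_iff:
  "\<lbrakk>x \<in> kite_carrier G I J; y \<in> kite_carrier G I J; z \<in> kite_carrier G I J\<rbrakk>
    \<Longrightarrow> kite_leq G I J (kite_join x y) z \<longleftrightarrow> kite_leq G I J x z \<and> kite_leq G I J y z"
  by (elim kite_carrier_cases) (auto simp: memD)

lemma kite_leq_meet_iff:
  "\<lbrakk>x \<in> kite_carrier G I J; y \<in> kite_carrier G I J; z \<in> kite_carrier G I J\<rbrakk>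
    \<Longrightarrow> kite_leq G I J z (kite_meet x y) \<longleftrightarrow> kite_leq G I J z x \<and> kite_leq G I J z y"
  by (elim kite_carrier_cases) (auto simp: memD)

lemma lattice_kite: "lattice (poset_of K)"
proof (rule lattice_poset_ofI[where s = kite_join and m = kite_meet])
  show "leq K x x" if "x \<in> carrier K" for x
    using that by (auto elim!: kite_carrier_cases simp: memD)
  show "x = y" if "x \<in> carrier K" "y \<in> carrier K" "leq K x y" "leq K y x" for x y
    using that
    by (auto elim!: kite_carrier_cases simp: pos_eq_iff neg_eq_iff memD intro!: leq_antisym)
  show "leq K x z"
    if "x \<in> carrier K" "y \<in> carrier K" "z \<in> carrier K" "leq K x y" "leq K y z" for x y z
  proof -
    \<comment> \<open>Only chains within a single summand need an argument: a positive sequence lies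
      below every negative one, and never conversely.\<close>
    have pos: "f j \<preceq> h j"
      if "f \<in> J \<rightarrow>\<^sub>E pos_cone G" "g \<in> J \<rightarrow>\<^sub>E pos_cone G" "h \<in> J \<rightarrow>\<^sub>E pos_cone G"
        "\<forall>j\<in>J. f j \<preceq> g j" "\<forall>j\<in>J. g j \<preceq> h j" "j \<in> J" for f g h j
      using that leq_trans[of "f j" "g j" "h j"] by (simp add: memD)
    have neg: "a i \<preceq> c i"
      if "a \<in> I \<rightarrow>\<^sub>E neg_cone G" "b \<in> I \<rightarrow>\<^sub>E neg_cone G" "c \<in> I \<rightarrow>\<^sub>E neg_cone G"
        "\<forall>i\<in>I. a i \<preceq> b i" "\<forall>i\<in>I. b i \<preceq> c i" "i \<in> I" for a b c i
      using that leq_trans[of "a i" "b i" "c i"] by (simp add: memD)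
    show ?thesis
      using that unfolding kite_simps
      by (elim kite_carrier_cases; simp) (use pos neg in blast)+
  qed
qed (simp_all add: kite_join_closed kite_meet_closed kite_join_leq_iff kite_leq_meet_iff)

sublocale kite_lattice: lattice "poset_of K"
  by (rule lattice_kite)

text \<open>Makes the abstract join of \<open>poset_of K\<close> computable, so that prelinearity
  can be checked in coordinates.\<close>

lemma poset_join_kite:
  "\<lbrakk>x \<in> kite_carrier G I J; y \<in> kite_carrier G I J\<rbrakk> \<Longrightarrow> x \<^bold>\<or>\<^bsub>K\<^esub> y = kite_join x y"
  by (rule kite_lattice.join_eqI) (simp_all add: kite_join_closed kite_join_leq_iff)

lemma poset_meet_kite:
  "\<lbrakk>x \<in> kite_carrier G I J; y \<in> kite_carrier G I J\<rbrakk> \<Longrightarrow> x \<^bold>\<and>\<^bsub>K\<^esub> y = kite_meet x y"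
  by (rule kite_lattice.meet_eqI) (simp_all add: kite_meet_closed kite_leq_meet_iff)

section \<open>Residuation\<close>

lemma kite_ldiv_residual:
  assumes "x \<in> kite_carrier G I J" "y \<in> kite_carrier G I J" "z \<in> kite_carrier G I J"
  shows "kite_leq G I J (kite_mult G I J lam rho x y) z
    \<longleftrightarrow> kite_leq G I J y (kite_ldiv G I J lam rho x z)"
proof -
  \<comment> \<open>The one case where the index sets differ: the product is compared over J, the
    quotient over I. The truncations are already gone here, as \<open>g j\<close> is above the
    identity and \<open>a i\<close> below it, and off the image of \<open>rho\<close> nothing is
    asked of \<open>a\<close>.\<close>
  have "(\<forall>j\<in>J. f j \<otimes> a (rho j) \<preceq> g j) \<longleftrightarrow>
      (\<forall>i\<in>I. i \<in> rho ` J \<longrightarrow> a i \<preceq> inv (f (inv_into J rho i)) \<otimes> g (inv_into J rho i))"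
    if "f \<in> J \<rightarrow>\<^sub>E pos_cone G" "a \<in> I \<rightarrow>\<^sub>E neg_cone G" "g \<in> J \<rightarrow>\<^sub>E pos_cone G" for f a g
    using that
    by (subst ball_inv_into_iff[OF rho, of "\<lambda>j i. a i \<preceq> inv (f j) \<otimes> g j"])
      (simp add: mult_leq_iff_left memD)
  with assms show ?thesis
    by (elim kite_carrier_cases)
      (auto simp: kite_one_def kite_zero_def memD mult_leq_iff_left inv_mult_group)
qed

lemma kite_rdiv_residual:
  assumes "x \<in> kite_carrier G I J" "y \<in> kite_carrier G I J" "z \<in> kite_carrier G I J"
  shows "kite_leq G I J (kite_mult G I J lam rho x y) z
    \<longleftrightarrow> kite_leq G I J x (kite_rdiv G I J lam rho z y)"
proof -
  \<comment> \<open>The mirror image: the negative factor now stands on the left and is read through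
    \<open>lam\<close>.\<close>
  have "(\<forall>j\<in>J. a (lam j) \<otimes> f j \<preceq> g j) \<longleftrightarrow>
      (\<forall>i\<in>I. i \<in> lam ` J \<longrightarrow> a i \<preceq> g (inv_into J lam i) \<otimes> inv (f (inv_into J lam i)))"
    if "f \<in> J \<rightarrow>\<^sub>E pos_cone G" "a \<in> I \<rightarrow>\<^sub>E neg_cone G" "g \<in> J \<rightarrow>\<^sub>E pos_cone G" for f a g
    using that
    by (subst ball_inv_into_iff[OF lam, of "\<lambda>j i. a i \<preceq> g j \<otimes> inv (f j)"])
      (simp add: mult_leq_iff_right memD)
  with assms show ?thesis
    by (elim kite_carrier_cases)
      (auto simp: kite_one_def kite_zero_def memD mult_leq_iff_right inv_mult_group)
qed

section \<open>Divisibility and prelinearity\<close>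

lemma kite_left_divisibility:
  assumes "x \<in> kite_carrier G I J" "y \<in> kite_carrier G I J"
  shows "kite_mult G I J lam rho x (kite_ldiv G I J lam rho x (kite_meet x y)) = kite_meet x y"
  using assms(1)
proof (cases rule: kite_carrier_cases)
  \<comment> \<open>Multiplying \<open>f\<close> on the right reads the quotient only at
    \<open>rho j\<close>, where \<open>inv_into\<close> returns j. The result is a coordinate of the
    meet, so it is above the identity and the outer join is absorbed.\<close>
  case x: (pos f)
  from assms(2) show ?thesis
    by (cases rule: kite_carrier_cases)
      (use x in \<open>auto simp: memD rho inv_into_f_f mult_division_meet poset_join_absorb
        poset_meet_absorb intro: restrict_ext restrict_eqI\<close>)
next
  \<comment> \<open>If y is positive, the meet is y itself and the untruncated quotient cancels; if
    y is negative, \<open>mult_division_meet\<close> applies at each index of I.\<close>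
  case x: (neg a)
  from assms(2) show ?thesis
    by (cases rule: kite_carrier_cases)
      (use x in \<open>auto simp: memD mult_division_meet mult_inv_cancel poset_join_absorb
        inv_mult_group intro: restrict_ext restrict_eqI\<close>)
qed

lemma kite_right_divisibility:
  assumes "x \<in> kite_carrier G I J" "y \<in> kite_carrier G I J"
  shows "kite_mult G I J lam rho (kite_rdiv G I J lam rho (kite_meet x y) x) x = kite_meet x y"
  using assms(1)
proof (cases rule: kite_carrier_cases)
  case x: (pos f)
  from assms(2) show ?thesis
    by (cases rule: kite_carrier_cases)
      (use x in \<open>auto simp: memD lam inv_into_f_f mult_division_meet poset_join_absorb
        poset_meet_absorb intro: restrict_ext restrict_eqI\<close>)
next
  case x: (neg a)
  from assms(2) show ?thesis
    by (cases rule: kite_carrier_cases)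
      (use x in \<open>auto simp: memD mult_division_meet mult_inv_cancel poset_join_absorb
        inv_mult_group intro: restrict_ext restrict_eqI\<close>)
qed

text \<open>For a mixed pair one quotient is already the unit and the other is positive, hence below
  it. Otherwise \<open>left_prelinear\<close> applies in each coordinate, except off the image of
  \<open>rho\<close>, where both quotients equal the identity.\<close>

lemma kite_left_prelinearity:
  assumes "x \<in> kite_carrier G I J" "y \<in> kite_carrier G I J"
  shows "kite_join (kite_ldiv G I J lam rho x y) (kite_ldiv G I J lam rho y x) = kite_one G I"
  using assms
  by (elim kite_carrier_cases)
    (auto simp: kite_one_def memD left_prelinear poset_join_absorb join_one_neg intro!: restrict_ext)

lemma kite_right_prelinearity:
  assumes "x \<in> kite_carrier G I J" "y \<in> kite_carrier G I J"
  shows "kite_join (kite_rdiv G I J lam rho y x) (kite_rdiv G I J lam rho x y) = kite_one G I"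
  using assms
  by (elim kite_carrier_cases)
    (auto simp: kite_one_def memD right_prelinear poset_join_absorb join_one_neg intro!: restrict_ext)

lemma pseudo_bl_algebra_kite: "pseudo_bl_algebra K"
proof
  fix x assume "x \<in> carrier K"
  then show "\<zero>\<^bsub>K\<^esub> \<preceq>\<^bsub>K\<^esub> x" "x \<preceq>\<^bsub>K\<^esub> \<one>\<^bsub>K\<^esub>"
    by (auto elim!: kite_carrier_cases simp: kite_zero_def kite_one_def memD)
next
  fix x y z assume "x \<in> carrier K" "y \<in> carrier K" "z \<in> carrier K"
  then show "x \<otimes>\<^bsub>K\<^esub> y \<preceq>\<^bsub>K\<^esub> z \<longleftrightarrow> y \<preceq>\<^bsub>K\<^esub> ldiv K x z"
    and "x \<otimes>\<^bsub>K\<^esub> y \<preceq>\<^bsub>K\<^esub> z \<longleftrightarrow> x \<preceq>\<^bsub>K\<^esub> rdiv K z y"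
    using kite_ldiv_residual kite_rdiv_residual by auto
qed (simp_all add: kite_mult_closed kite_one_closed kite_zero_closed kite_mult_assoc kite_mult_one
    kite_ldiv_closed kite_rdiv_closed
    poset_meet_kite poset_join_kite kite_left_divisibility kite_right_divisibility
    kite_left_prelinearity kite_right_prelinearity)

end

theorem lemma3p2:
  fixes G :: "('g, 'm) ordered_monoid_scheme"
    and I :: "'i set" and J :: "'j set"
    and lam :: "'j \<Rightarrow> 'i" and rho :: "'j \<Rightarrow> 'i"
  assumes "l_group G"
    and "J \<lesssim> I"
    and "lam \<in> J \<rightarrow> I" and "inj_on lam J"
    and "rho \<in> J \<rightarrow> I" and "inj_on rho J"
  shows "pseudo_bl_algebra (kite G I J lam rho)"
proof -
  interpret kite_index G I J lam rho
    using assms by (simp add: kite_index_def kite_index_axioms_def)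
  show ?thesis
    by (rule pseudo_bl_algebra_kite)
qed

end
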